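(* For all constants $c,c'>0$ there is a constant $C>0$ such that the following holds in the spherical Gaussian mixture setting described in the context. If $K>0$ and $$c\,k\sigma\le\Delta_{\min}\le\Delta_{\max}\le c'K\sigma,$$ then $$\frac1N\sum_{a=1}^k\sum_{i=1}^n\|c_{a,i}-\tilde\gamma_a\|_2^2\le C\,K^2\sigma^2$$ with high probability as $n\to\infty$ (i.e. with probability tending to $1$ as $n\to\infty$, all other parameters being fixed).
   Context: Setting. Let $k\ge2$, $m\ge1$, $\sigma>0$, and let $\gamma_1,\dots,\gamma_k\in\mathbb R^m$ be distinct. For each $a\in\{1,\dots,k\}$, $n$ points $x_{a,1},\dots,x_{a,n}$ are drawn from $\mathcal N(\gamma_a,\sigma^2I_m)$, all points independent; $N=kn$. $\Delta_{\min}=\min_{a\neq b}\|\gamma_a-\gamma_b\|_2$, $\Delta_{\max}=\max_{a\ne b}\|\gamma_a-\gamma_b\|_2$. $\tilde\gamma_a:=\frac1n\sum_{i=1}^n x_{a,i}$ is the centroid of the $a$th cluster. $D$ is the $N\times N$ matrix of squared Euclidean distances between the points, and $X_D$ is a minimizer of $$\text{minimize } \operatorname{Tr}(DX)\quad\text{subject to}\quad \operatorname{Tr}(X)=k,\ X1=1,\ X\ge0 \text{ (entrywise)},\ X\succeq0 .$$ $P$ is the $m\times N$ matrix whose $(a,i)$th column is $x_{a,i}$, and $c_{a,i}$ denotes the $(a,i)$th column of $PX_D$. *)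

theory Defs
  imports "HOL-Probability.Probability" "Jordan_Normal_Form.Matrix"
begin

hide_const (open) Finite_Cartesian_Product.vec Finite_Cartesian_Product.mat Determinants.trace
no_notation Finite_Cartesian_Product.vec_nth (infixl \<open>$\<close> 90)

definition l2norm :: "real vec \<Rightarrow> real" where
  "l2norm v = sqrt (scalar_prod v v)"

definition trace :: "real mat \<Rightarrow> real" where
  "trace A = (\<Sum>p<dim_row A. A $$ (p, p))"

definition psd :: "nat \<Rightarrow> real mat \<Rightarrow> bool" where
  "psd N A \<longleftrightarrow> A \<in> carrier_mat N N \<and> transpose_mat A = A \<and>
     (\<forall>v\<in>carrier_vec N. 0 \<le> scalar_prod v (A *\<^sub>v v))"

(* The law N(mu, sigma^2 I_m), by its independent coordinates, on the function space R^{0,...,m-1};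
   the second parameter of normal_density is the standard deviation. *)
definition spherical_gaussian :: "nat \<Rightarrow> real vec \<Rightarrow> real \<Rightarrow> (nat \<Rightarrow> real) measure" where
  "spherical_gaussian m \<mu> \<sigma> = Pi\<^sub>M {..<m} (\<lambda>j. density lborel (normal_density (\<mu> $ j) \<sigma>))"

(* Joint law of the independent points x (a, i), a < k, i < n; clusters, points and coordinates
   are numbered from 0. *)
definition mixture_sample ::
  "nat \<Rightarrow> nat \<Rightarrow> nat \<Rightarrow> (nat \<Rightarrow> real vec) \<Rightarrow> real \<Rightarrow> (nat \<times> nat \<Rightarrow> nat \<Rightarrow> real) measure" where
  "mixture_sample m k n \<gamma> \<sigma> =
     Pi\<^sub>M ({..<k} \<times> {..<n}) (\<lambda>(a, i). spherical_gaussian m (\<gamma> a) \<sigma>)"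

(* The index (a, i) is encoded as column a * n + i. *)
definition data_mat :: "nat \<Rightarrow> nat \<Rightarrow> nat \<Rightarrow> (nat \<times> nat \<Rightarrow> nat \<Rightarrow> real) \<Rightarrow> real mat" where
  "data_mat m k n x = mat m (k * n) (\<lambda>(j, p). x (p div n, p mod n) j)"

definition sq_dist_mat :: "real mat \<Rightarrow> real mat" where
  "sq_dist_mat P = mat (dim_col P) (dim_col P) (\<lambda>(p, q). (l2norm (col P p - col P q))\<^sup>2)"

definition centroid :: "nat \<Rightarrow> nat \<Rightarrow> (nat \<times> nat \<Rightarrow> nat \<Rightarrow> real) \<Rightarrow> nat \<Rightarrow> real vec" where
  "centroid m n x a = vec m (\<lambda>j. 1 / real n * (\<Sum>i<n. x (a, i) j))"

definition sdp_feasible :: "nat \<Rightarrow> nat \<Rightarrow> real mat \<Rightarrow> bool" where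
  "sdp_feasible k N X \<longleftrightarrow>
     X \<in> carrier_mat N N \<and> trace X = real k \<and> X *\<^sub>v vec N (\<lambda>_. 1) = vec N (\<lambda>_. 1) \<and>
     (\<forall>p<N. \<forall>q<N. 0 \<le> X $$ (p, q)) \<and> psd N X"

definition sdp_minimizer :: "nat \<Rightarrow> nat \<Rightarrow> real mat \<Rightarrow> real mat \<Rightarrow> bool" where
  "sdp_minimizer k N D X \<longleftrightarrow> is_arg_min (\<lambda>Y. trace (D * Y)) (sdp_feasible k N) X"

definition center_dists :: "nat \<Rightarrow> (nat \<Rightarrow> real vec) \<Rightarrow> real set" where
  "center_dists k \<gamma> = {l2norm (\<gamma> a - \<gamma> b) | a b. a < k \<and> b < k \<and> a \<noteq> b}"

definition \<Delta>_min :: "nat \<Rightarrow> (nat \<Rightarrow> real vec) \<Rightarrow> real" where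
  "\<Delta>_min k \<gamma> = Min (center_dists k \<gamma>)"

definition \<Delta>_max :: "nat \<Rightarrow> (nat \<Rightarrow> real vec) \<Rightarrow> real" where
  "\<Delta>_max k \<gamma> = Max (center_dists k \<gamma>)"

(* Q n holds with M n-probability tending to 1. The events E n make this meaningful without
   assuming that {w. Q n w} is measurable; if it is, E n can be taken to be that set. *)
definition with_high_probability :: "(nat \<Rightarrow> 'a measure) \<Rightarrow> (nat \<Rightarrow> 'a \<Rightarrow> bool) \<Rightarrow> bool" where
  "with_high_probability M Q \<longleftrightarrow>
     (\<exists>E. (\<forall>n. E n \<in> sets (M n)) \<and> (\<forall>n. \<forall>\<omega>\<in>E n. Q n \<omega>) \<and>
          (\<lambda>n. measure (M n) (E n)) \<longlonglongrightarrow> 1)"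

end

theory Submission
  imports Defs
begin

text \<open>
  Let \<open>X\<close> be feasible for the relaxation. Write the data matrix as \<open>P = M + G\<close>,
  where \<open>M\<close> repeats the centers and \<open>G\<close> is the noise, and let \<open>Z\<close> be the block-diagonal averaging
  matrix, so that \<open>P Z\<close> has the centroids as its columns and \<open>M Z = M\<close>. The columns of
  \<open>M (X - Z)\<close> are convex combinations of differences of centers, hence of norm at most
  \<open>\<Delta>_max\<close>. For the noise, the Frobenius norm of \<open>G (X - Z)\<close> is at most the operator norm of \<open>G\<close> times
  the Frobenius norm of \<open>X - Z\<close>. Feasibility bounds the squared Frobenius norms of \<open>X\<close> and \<open>Z\<close> by
  \<open>k\<close>. Since \<open>m\<close> is fixed, Chebyshev's inequality for each entry of the \<open>m \<times> m\<close> matrix \<open>G G\<^sup>T\<close>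
  shows that it is close to \<open>N \<sigma>\<^sup>2 I\<close> with high probability, so the squared operator norm is
  at most \<open>2 N \<sigma>\<^sup>2\<close>. Finally \<open>k \<le> k\<^sup>2 \<le> (c' K / c)\<^sup>2\<close> by the separation hypothesis.
\<close>

section \<open>Quadratic inequalities for finite sums\<close>

text \<open>Cauchy-Schwarz after splitting each weight as
  \<open>sqrt (w q) * sqrt (w q)\<close>.\<close>

lemma weighted_mean_square_le:
  fixes w t :: "'q \<Rightarrow> real"
  assumes w0: "\<And>q. q \<in> Q \<Longrightarrow> 0 \<le> w q" and w1: "sum w Q = 1"
  shows "(\<Sum>q\<in>Q. w q * t q)\<^sup>2 \<le> (\<Sum>q\<in>Q. w q * (t q)\<^sup>2)"
proof -
  have "(\<Sum>q\<in>Q. w q * t q)\<^sup>2 = (\<Sum>q\<in>Q. sqrt (w q) * (sqrt (w q) * t q))\<^sup>2"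
    using w0 by (intro arg_cong[where f = "\<lambda>s. s\<^sup>2"] sum.cong) (auto simp flip: mult.assoc)
  also have "\<dots> \<le> (\<Sum>q\<in>Q. (sqrt (w q))\<^sup>2) * (\<Sum>q\<in>Q. (sqrt (w q) * t q)\<^sup>2)"
    by (rule Cauchy_Schwarz_ineq_sum)
  also have "\<dots> = (\<Sum>q\<in>Q. w q * (t q)\<^sup>2)"
    using w0 w1 by (simp add: power_mult_distrib)
  finally show ?thesis .
qed

text \<open>Let G have the columns \<open>g q\<close>. Each entry of G G^T is within
  \<open>s / card J\<close> of that of s I, so the difference has operator norm at most s and G G^T
  is at most 2 s I. This yields |G y|^2 \<le> 2 s |y|^2 by duality: u = G y satisfies |u|^2 = <y,
  G^T u> \<le> |y| |G^T u|, where |G^T u|^2 = <u, G G^T u> \<le> 2 s |u|^2.\<close>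

lemma sum_near_scalar_Gram_le:
  fixes g :: "'q \<Rightarrow> 'j \<Rightarrow> real" and y :: "'q \<Rightarrow> real"
  assumes fin: "finite J" and s: "0 \<le> s"
    and Gram: "\<And>j l. j \<in> J \<Longrightarrow> l \<in> J \<Longrightarrow>
      \<bar>(\<Sum>q\<in>Q. g q j * g q l) - (if j = l then s else 0)\<bar> \<le> s / card J"
  shows "(\<Sum>j\<in>J. (\<Sum>q\<in>Q. y q * g q j)\<^sup>2) \<le> 2 * s * (\<Sum>q\<in>Q. (y q)\<^sup>2)"
proof -
  define u where "u j = (\<Sum>q\<in>Q. y q * g q j)" for j
  define U where "U = (\<Sum>j\<in>J. (u j)\<^sup>2)"
  define S where "S j l = (\<Sum>q\<in>Q. g q j * g q l)" for j l
  have U0: "0 \<le> U" by (simp add: U_def sum_nonneg)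
  have dual: "U = (\<Sum>q\<in>Q. y q * (\<Sum>j\<in>J. u j * g q j))"
  proof -
    have "U = (\<Sum>j\<in>J. \<Sum>q\<in>Q. y q * (u j * g q j))"
      unfolding U_def by (intro sum.cong refl) (simp add: power2_eq_square u_def sum_distrib_left mult_ac)
    then show ?thesis by (subst (asm) sum.swap) (simp add: sum_distrib_left)
  qed
  have quad: "(\<Sum>q\<in>Q. (\<Sum>j\<in>J. u j * g q j)\<^sup>2) = (\<Sum>j\<in>J. \<Sum>l\<in>J. u j * u l * S j l)"
  proof -
    have "(\<Sum>q\<in>Q. (\<Sum>j\<in>J. u j * g q j)\<^sup>2) = (\<Sum>q\<in>Q. \<Sum>j\<in>J. \<Sum>l\<in>J. u j * u l * (g q j * g q l))"
      by (simp add: power2_eq_square sum_product mult_ac)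
    also have "\<dots> = (\<Sum>j\<in>J. \<Sum>q\<in>Q. \<Sum>l\<in>J. u j * u l * (g q j * g q l))"
      by (rule sum.swap)
    also have "\<dots> = (\<Sum>j\<in>J. \<Sum>l\<in>J. \<Sum>q\<in>Q. u j * u l * (g q j * g q l))"
      by (intro sum.cong refl sum.swap)
    finally show ?thesis by (simp add: S_def sum_distrib_left)
  qed
  have "(\<Sum>j\<in>J. \<Sum>l\<in>J. u j * u l * S j l)
      \<le> (\<Sum>j\<in>J. \<Sum>l\<in>J. (if j = l then s * (u j * u l) else 0) + s / card J * (\<bar>u j\<bar> * \<bar>u l\<bar>))"
  proof (intro sum_mono)
    fix j l assume jl: "j \<in> J" "l \<in> J"
    let ?d = "if j = l then s else 0"
    have "u j * u l * (S j l - ?d) \<le> \<bar>u j * u l\<bar> * \<bar>S j l - ?d\<bar>"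
      by (metis abs_ge_self abs_mult)
    also have "\<dots> \<le> \<bar>u j * u l\<bar> * (s / card J)"
      using Gram[OF jl] by (intro mult_left_mono) (auto simp: S_def)
    finally show "u j * u l * S j l \<le>
        (if j = l then s * (u j * u l) else 0) + s / card J * (\<bar>u j\<bar> * \<bar>u l\<bar>)"
      by (auto simp: algebra_simps abs_mult split: if_splits)
  qed
  also have "\<dots> = s * U + s / card J * (\<Sum>j\<in>J. \<bar>u j\<bar>)\<^sup>2"
  proof -
    have "(\<Sum>j\<in>J. \<Sum>l\<in>J. s / card J * (\<bar>u j\<bar> * \<bar>u l\<bar>)) = s / card J * (\<Sum>j\<in>J. \<bar>u j\<bar>)\<^sup>2"
      by (simp only: power2_eq_square sum_product) (simp only: sum_distrib_left)
    then show ?thesis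
      using fin by (simp add: sum.distrib U_def power2_eq_square flip: sum_distrib_left)
  qed
  also have "\<dots> \<le> s * U + s * U"
  proof -
    \<comment> \<open>Cauchy-Schwarz against the all-ones vector costs a factor
      \<open>card J\<close>, which the tolerance \<open>s / card J\<close> absorbs.\<close>
    have "(\<Sum>j\<in>J. 1 * \<bar>u j\<bar>)\<^sup>2 \<le> (\<Sum>j\<in>J. 1\<^sup>2) * (\<Sum>j\<in>J. \<bar>u j\<bar>\<^sup>2)"
      by (rule Cauchy_Schwarz_ineq_sum)
    then have "s / card J * (\<Sum>j\<in>J. \<bar>u j\<bar>)\<^sup>2 \<le> s / card J * (card J * U)"
      using s by (intro mult_left_mono) (auto simp: U_def)
    \<comment> \<open>Only an inequality, because for empty \<open>J\<close> the quotient by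
      \<open>card J\<close> is 0.\<close>
    also have "\<dots> \<le> s * U" using s U0 by simp
    finally show ?thesis by (rule add_left_mono)
  qed
  finally have "(\<Sum>q\<in>Q. (\<Sum>j\<in>J. u j * g q j)\<^sup>2) \<le> 2 * s * U"
    by (simp only: quad mult_2 distrib_right)
  then have "(\<Sum>q\<in>Q. (y q)\<^sup>2) * (\<Sum>q\<in>Q. (\<Sum>j\<in>J. u j * g q j)\<^sup>2) \<le> (\<Sum>q\<in>Q. (y q)\<^sup>2) * (2 * s * U)"
    by (rule mult_left_mono) (simp add: sum_nonneg)
  moreover have "U\<^sup>2 \<le> (\<Sum>q\<in>Q. (y q)\<^sup>2) * (\<Sum>q\<in>Q. (\<Sum>j\<in>J. u j * g q j)\<^sup>2)"
    by (subst dual) (rule Cauchy_Schwarz_ineq_sum)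
  ultimately have "U * U \<le> (2 * s * (\<Sum>q\<in>Q. (y q)\<^sup>2)) * U"
    by (simp add: power2_eq_square mult_ac)
  moreover have "0 \<le> 2 * s * (\<Sum>q\<in>Q. (y q)\<^sup>2)"
    using s by (simp add: sum_nonneg)
  \<comment> \<open>A factor \<open>U\<close> is cancelled; if \<open>U = 0\<close>, nonnegativity
    of the right-hand side suffices.\<close>
  ultimately have "U \<le> 2 * s * (\<Sum>q\<in>Q. (y q)\<^sup>2)"
    using U0 by (cases "U = 0") (simp_all add: mult_le_cancel_right)
  then show ?thesis by (simp add: U_def u_def)
qed

section \<open>Feasible matrices of the relaxation\<close>

text \<open>The quadratic form is tested on the difference of two unit vectors.\<close>

lemma psd_offdiag_le:
  assumes X: "psd N X" and "p < N" "q < N"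
  shows "2 * X $$ (p, q) \<le> X $$ (p, p) + X $$ (q, q)"
proof (cases "p = q")
  case False
  have cX: "X \<in> carrier_mat N N" and sym: "transpose_mat X = X" using X by (auto simp: psd_def)
  define v :: "real vec" where "v = unit_vec N p - unit_vec N q"
  have v: "v \<in> carrier_vec N" by (simp add: v_def)
  have Xqp: "X $$ (q, p) = X $$ (p, q)"
    using sym cX assms(2,3) by (metis carrier_matD index_transpose_mat(1))
  have "v \<bullet> (X *\<^sub>v v) = X $$ (p, p) - X $$ (p, q) - X $$ (q, p) + X $$ (q, q)"
    using cX assms(2,3)
    by (simp add: v_def mult_minus_distrib_mat_vec[OF cX] minus_scalar_prod_distrib[of _ N]
        scalar_prod_left_unit mult_mat_vec_def scalar_prod_right_unit scalar_prod_minus_distrib[of _ N])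
  moreover have "0 \<le> v \<bullet> (X *\<^sub>v v)" using X v by (auto simp: psd_def)
  ultimately show ?thesis using Xqp by simp
qed simp

lemma sdp_feasibleD:
  assumes "sdp_feasible k N X"
  shows "X \<in> carrier_mat N N" "(\<Sum>p<N. X $$ (p, p)) = real k" "psd N X"
    and "\<And>p q. p < N \<Longrightarrow> q < N \<Longrightarrow> 0 \<le> X $$ (p, q)"
    and "\<And>p. p < N \<Longrightarrow> (\<Sum>q<N. X $$ (p, q)) = 1"
    and "\<And>p q. p < N \<Longrightarrow> q < N \<Longrightarrow> X $$ (q, p) = X $$ (p, q)"
proof -
  show cX: "X \<in> carrier_mat N N" and P: "psd N X" using assms by (auto simp: sdp_feasible_def)
  then show "(\<Sum>p<N. X $$ (p, p)) = real k" "\<And>p q. p < N \<Longrightarrow> q < N \<Longrightarrow> 0 \<le> X $$ (p, q)"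
    using assms by (auto simp: sdp_feasible_def trace_def)
  show "X $$ (q, p) = X $$ (p, q)" if "p < N" "q < N" for p q
    using P cX that by (metis psd_def carrier_matD index_transpose_mat(1))
  show "(\<Sum>q<N. X $$ (p, q)) = 1" if p: "p < N" for p
  proof -
    have "(X *\<^sub>v vec N (\<lambda>_. 1)) $ p = vec N (\<lambda>_. 1) $ p" using assms by (simp add: sdp_feasible_def)
    then show ?thesis using p cX by (simp add: scalar_prod_def lessThan_atLeast0)
  qed
qed

text \<open>Since entries are nonnegative, \<open>psd_offdiag_le\<close> bounds each squared entry
  by the entry times the mean of two diagonal entries. As rows and columns sum to 1, summation
  leaves exactly the trace.\<close>

lemma sdp_feasible_Frobenius_le:
  assumes "sdp_feasible k N X"
  shows "(\<Sum>p<N. \<Sum>q<N. (X $$ (q, p))\<^sup>2) \<le> real k"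
proof -
  note X = sdp_feasibleD[OF assms]
  \<comment> \<open>The second summand uses the transposed entry, so that exchanging the sums turns
    it into a copy of the first.\<close>
  have "(\<Sum>p<N. \<Sum>q<N. (X $$ (q, p))\<^sup>2)
      \<le> (\<Sum>p<N. \<Sum>q<N. X $$ (q, p) * (X $$ (p, p) / 2) + X $$ (p, q) * (X $$ (q, q) / 2))"
  proof (intro sum_mono)
    fix p q assume "p \<in> {..<N}" "q \<in> {..<N}"
    then have pq: "p < N" "q < N" by auto
    have "X $$ (q, p) * X $$ (q, p) \<le> X $$ (q, p) * ((X $$ (p, p) + X $$ (q, q)) / 2)"
      using psd_offdiag_le[OF X(3) pq(2,1)] X(4)[OF pq(2,1)] by (intro mult_left_mono) auto
    then show "(X $$ (q, p))\<^sup>2 \<le> X $$ (q, p) * (X $$ (p, p) / 2) + X $$ (p, q) * (X $$ (q, q) / 2)"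
      using X(6)[OF pq] by (simp add: power2_eq_square algebra_simps)
  qed
  also have "\<dots> = (\<Sum>p<N. \<Sum>q<N. X $$ (q, p) * (X $$ (p, p) / 2)) +
      (\<Sum>q<N. \<Sum>p<N. X $$ (p, q) * (X $$ (q, q) / 2))"
    by (simp add: sum.distrib) (rule sum.swap)
  also have "\<dots> = (\<Sum>p<N. X $$ (p, p))"
  proof -
    have "(\<Sum>q<N. X $$ (q, p)) = 1" if "p < N" for p
      using X(5,6) that by (metis (mono_tags, lifting) lessThan_iff sum.cong)
    then have "(\<Sum>p<N. \<Sum>q<N. X $$ (q, p) * (X $$ (p, p) / 2)) = (\<Sum>p<N. X $$ (p, p) / 2)"
      by (simp only: flip: sum_distrib_right) simp
    then show ?thesis by (simp flip: sum_divide_distrib)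
  qed
  finally show ?thesis using X(2) by simp
qed

section \<open>Norms, block indexing and distances of centers\<close>

lemma l2norm_power2: "(l2norm v)\<^sup>2 = (\<Sum>j<dim_vec v. (v $ j)\<^sup>2)"
proof -
  have "0 \<le> v \<bullet> v" by (simp add: scalar_prod_def sum_nonneg)
  then show ?thesis
    by (simp add: l2norm_def scalar_prod_def power2_eq_square lessThan_atLeast0)
qed

lemma sum_blocks:
  fixes f :: "nat \<Rightarrow> 'b::comm_monoid_add"
  shows "(\<Sum>a<k. \<Sum>i<n. f (a * n + i)) = (\<Sum>p<k * n. f p)"
proof -
  have "(\<Sum>i<n. f (a * n + i)) = sum f {a * n..<a * n + n}" for a
    using sum.shift_bounds_nat_ivl[of f 0 "a * n" n]
    by (simp add: lessThan_atLeast0 add.commute)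
  then show ?thesis by (simp add: sum.nat_group)
qed

lemma sum_block_indicator:
  fixes f :: "nat \<Rightarrow> real"
  assumes a: "a < k"
  shows "(\<Sum>q<k * n. if q div n = a then f q else 0) = (\<Sum>i<n. f (a * n + i))"
proof -
  have "(\<Sum>q<k * n. if q div n = a then f q else 0) = (\<Sum>b<k. \<Sum>i<n. if b = a then f (b * n + i) else 0)"
    unfolding sum_blocks[symmetric] by (intro sum.cong refl) auto
  also have "\<dots> = (\<Sum>b<k. if b = a then \<Sum>i<n. f (b * n + i) else 0)"
    by (intro sum.cong refl) auto
  also have "\<dots> = (\<Sum>i<n. f (a * n + i))" using a by simp
  finally show ?thesis .
qed

text \<open>The squares extend the bound to \<open>a = b\<close>, where the distance 0 is not a
  member of \<open>center_dists\<close>.\<close>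

lemma l2norm_le_\<Delta>_max:
  assumes "a < k" "b < k"
  shows "(l2norm (\<gamma> a - \<gamma> b))\<^sup>2 \<le> (\<Delta>_max k \<gamma>)\<^sup>2"
proof (cases "a = b")
  case True
  then show ?thesis by (simp add: l2norm_power2)
next
  case False
  have "center_dists k \<gamma> \<subseteq> (\<lambda>(a, b). l2norm (\<gamma> a - \<gamma> b)) ` ({..<k} \<times> {..<k})"
    by (auto simp: center_dists_def)
  then have "finite (center_dists k \<gamma>)" by (rule finite_subset) auto
  then have "l2norm (\<gamma> a - \<gamma> b) \<le> \<Delta>_max k \<gamma>"
    unfolding \<Delta>_max_def using False assms by (intro Max_ge) (auto simp: center_dists_def)
  moreover have "0 \<le> l2norm (\<gamma> a - \<gamma> b)"
    by (simp add: l2norm_def scalar_prod_def sum_nonneg)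
  ultimately show ?thesis by (rule power_mono)
qed

section \<open>Deterministic error bound\<close>

text \<open>The error of column \<open>p\<close> is A + B, with A a convex combination of
  differences of centers and B the noise matrix applied to column \<open>p\<close> of X - Z. The
  factor 8 is 2 * 2 * 2: from |A + B|^2 \<le> 2 |A|^2 + 2 |B|^2, from the operator norm bound
  \<open>2 * s\<close>, and from splitting the column of X - Z in the same way.\<close>

lemma sdp_column_error_le:
  fixes x :: "nat \<times> nat \<Rightarrow> nat \<Rightarrow> real"
  assumes X: "sdp_feasible k (k * n) X" and p: "p < k * n"
    and \<gamma>: "\<forall>a<k. \<gamma> a \<in> carrier_vec m" and s: "0 \<le> s"
    and Gram: "\<And>j l. j < m \<Longrightarrow> l < m \<Longrightarrow>
      \<bar>(\<Sum>q<k * n. (x (q div n, q mod n) j - \<gamma> (q div n) $ j) * (x (q div n, q mod n) l - \<gamma> (q div n) $ l))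
        - (if j = l then s else 0)\<bar> \<le> s / m"
  shows "(l2norm (col (data_mat m k n x * X) p - centroid m n x (p div n)))\<^sup>2
    \<le> 2 * (\<Delta>_max k \<gamma>)\<^sup>2 + 8 * s * ((\<Sum>q<k * n. (X $$ (q, p))\<^sup>2) + 1 / n)"
proof -
  note X = sdp_feasibleD[OF X]
  define N a where "N = k * n" and "a = p div n"
  have n: "0 < n" and a: "a < k" using p by (auto simp: a_def less_mult_imp_div_less intro: Nat.gr0I)
  define g where "g q j = x (q div n, q mod n) j - \<gamma> (q div n) $ j" for q j
  \<comment> \<open>\<open>z\<close> is column \<open>p\<close> of the averaging matrix Z, with
    weight \<open>1 / n\<close> on the cluster of \<open>p\<close>; \<open>y\<close> is column
    \<open>p\<close> of X - Z.\<close>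
  define z where "z q = (if q div n = a then 1 / real n else 0)" for q
  define y where "y q = X $$ (q, p) - z q" for q
  define A B where "A j = (\<Sum>q<N. X $$ (q, p) * (\<gamma> (q div n) $ j - \<gamma> a $ j))"
    and "B j = (\<Sum>q<N. y q * g q j)" for j
  have colsum: "(\<Sum>q<N. X $$ (q, p)) = 1"
    using X(5)[OF p] X(6)[OF p] by (simp add: N_def)
  have z: "(\<Sum>q<N. z q * h q) = 1 / n * (\<Sum>i<n. h (a * n + i))" for h
  proof -
    have "(\<Sum>q<N. z q * h q) = (\<Sum>q<N. if q div n = a then 1 / n * h q else 0)"
      by (intro sum.cong) (auto simp: z_def)
    then show ?thesis unfolding N_def sum_block_indicator[OF a] by (simp add: sum_distrib_left)
  qed
  \<comment> \<open>As column \<open>p\<close> of \<open>X\<close> sums to 1, the centers contribute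
    \<open>A j + \<gamma> a $ j\<close> to the product. The centroid is \<open>\<gamma> a\<close>
    plus the averaged noise of its cluster, so \<open>\<gamma> a\<close> cancels and the noise
    enters only through \<open>y\<close>.\<close>
  have entry: "(col (data_mat m k n x * X) p - centroid m n x a) $ j = A j + B j" if j: "j < m" for j
  proof -
    have "(col (data_mat m k n x * X) p) $ j = (\<Sum>q<N. X $$ (q, p) * x (q div n, q mod n) j)"
      using j p X(1) by (simp add: data_mat_def N_def scalar_prod_def lessThan_atLeast0 mult.commute)
    also have "\<dots> = (\<Sum>q<N. X $$ (q, p) * (g q j + \<gamma> (q div n) $ j))"
      by (simp add: g_def)
    also have "\<dots> = A j + \<gamma> a $ j + (\<Sum>q<N. X $$ (q, p) * g q j)"
      using colsum by (simp add: A_def algebra_simps sum.distrib sum_subtractf flip: sum_distrib_left)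
    finally have 1: "(col (data_mat m k n x * X) p) $ j = A j + \<gamma> a $ j + (\<Sum>q<N. X $$ (q, p) * g q j)" .
    have "(\<Sum>q<N. z q * g q j) = centroid m n x a $ j - \<gamma> a $ j"
      using n j by (simp add: z g_def centroid_def sum_subtractf diff_divide_distrib)
    then show ?thesis using 1 j
      by (simp add: B_def y_def algebra_simps sum_subtractf centroid_def)
  qed
  have dim: "dim_vec (centroid m n x a) = m" by (simp add: centroid_def)
  have "(l2norm (col (data_mat m k n x * X) p - centroid m n x a))\<^sup>2 = (\<Sum>j<m. (A j + B j)\<^sup>2)"
    unfolding l2norm_power2 using entry by (simp add: dim)
  also have "\<dots> \<le> (\<Sum>j<m. 2 * (A j)\<^sup>2 + 2 * (B j)\<^sup>2)"
  proof (rule sum_mono)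
    fix j show "(A j + B j)\<^sup>2 \<le> 2 * (A j)\<^sup>2 + 2 * (B j)\<^sup>2"
      using sum_squares_bound[of "A j" "B j"] by (simp add: power2_sum)
  qed
  also have "\<dots> = 2 * (\<Sum>j<m. (A j)\<^sup>2) + 2 * (\<Sum>j<m. (B j)\<^sup>2)"
    by (simp add: sum.distrib sum_distrib_left)
  finally have split: "(l2norm (col (data_mat m k n x * X) p - centroid m n x a))\<^sup>2
    \<le> 2 * (\<Sum>j<m. (A j)\<^sup>2) + 2 * (\<Sum>j<m. (B j)\<^sup>2)" .
  have A_le: "(\<Sum>j<m. (A j)\<^sup>2) \<le> (\<Delta>_max k \<gamma>)\<^sup>2"
  proof -
    have w: "0 \<le> X $$ (q, p)" if "q < N" for q using X(4) p that by (simp add: N_def)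
    \<comment> \<open>Jensen's inequality in each coordinate, with column \<open>p\<close> as
      weights; exchanging the sums then reassembles squared distances between centers.\<close>
    have "(\<Sum>j<m. (A j)\<^sup>2) \<le> (\<Sum>j<m. \<Sum>q<N. X $$ (q, p) * (\<gamma> (q div n) $ j - \<gamma> a $ j)\<^sup>2)"
      unfolding A_def using colsum w by (intro sum_mono weighted_mean_square_le) auto
    also have "\<dots> = (\<Sum>q<N. X $$ (q, p) * (\<Sum>j<m. (\<gamma> (q div n) $ j - \<gamma> a $ j)\<^sup>2))"
      by (subst sum.swap) (simp add: sum_distrib_left)
    also have "\<dots> \<le> (\<Sum>q<N. X $$ (q, p) * (\<Delta>_max k \<gamma>)\<^sup>2)"
    proof (intro sum_mono mult_left_mono)
      fix q assume "q \<in> {..<N}"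
      then have q: "q < N" "q div n < k" by (auto simp: N_def less_mult_imp_div_less)
      have "(\<Sum>j<m. (\<gamma> (q div n) $ j - \<gamma> a $ j)\<^sup>2) = (l2norm (\<gamma> (q div n) - \<gamma> a))\<^sup>2"
        unfolding l2norm_power2 using \<gamma> a q by (intro sum.cong) (auto dest!: spec[of _ a])
      then show "(\<Sum>j<m. (\<gamma> (q div n) $ j - \<gamma> a $ j)\<^sup>2) \<le> (\<Delta>_max k \<gamma>)\<^sup>2"
        using l2norm_le_\<Delta>_max[OF q(2) a] by simp
      show "0 \<le> X $$ (q, p)" by (rule w[OF q(1)])
    qed
    finally show ?thesis by (simp add: colsum flip: sum_distrib_right)
  qed
  have B_le: "(\<Sum>j<m. (B j)\<^sup>2) \<le> 2 * s * (\<Sum>q<N. (y q)\<^sup>2)"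
    unfolding B_def using s Gram
    by (intro sum_near_scalar_Gram_le) (auto simp: g_def N_def)
  have "(\<Sum>q<N. (y q)\<^sup>2) \<le> (\<Sum>q<N. 2 * (X $$ (q, p))\<^sup>2 + 2 * (z q)\<^sup>2)"
  proof (rule sum_mono)
    fix q show "(y q)\<^sup>2 \<le> 2 * (X $$ (q, p))\<^sup>2 + 2 * (z q)\<^sup>2"
      using sum_squares_bound[of "X $$ (q, p)" "- z q"] by (simp add: y_def power2_diff)
  qed
  also have "\<dots> = 2 * (\<Sum>q<N. (X $$ (q, p))\<^sup>2) + 2 * (1 / n)"
  proof -
    \<comment> \<open>Averaging \<open>z\<close> over its own block, where it is constantly
      \<open>1 / n\<close>.\<close>
    have "(\<Sum>q<N. (z q)\<^sup>2) = 1 / n * (\<Sum>i<n. z (a * n + i))"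
      unfolding power2_eq_square by (rule z)
    also have "\<dots> = 1 / n" using n by (simp add: z_def)
    finally show ?thesis by (simp add: sum.distrib flip: sum_distrib_left)
  qed
  finally have B2: "(\<Sum>j<m. (B j)\<^sup>2) \<le> 2 * s * (2 * (\<Sum>q<N. (X $$ (q, p))\<^sup>2) + 2 * (1 / n))"
    using s by (intro order_trans[OF B_le] mult_left_mono) auto
  have "(l2norm (col (data_mat m k n x * X) p - centroid m n x a))\<^sup>2
      \<le> 2 * (\<Delta>_max k \<gamma>)\<^sup>2 + 2 * (2 * s * (2 * (\<Sum>q<N. (X $$ (q, p))\<^sup>2) + 2 * (1 / n)))"
    using split A_le B2 by linarith
  also have "\<dots> = 2 * (\<Delta>_max k \<gamma>)\<^sup>2 + 8 * s * ((\<Sum>q<N. (X $$ (q, p))\<^sup>2) + 1 / n)"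
    by (simp add: algebra_simps)
  finally show ?thesis by (simp only: a_def N_def)
qed

text \<open>The column bounds are averaged with s = N \<sigma>^2, whose factor N cancels the
  prefactor 1 / N. The squared Frobenius norms of X and Z contribute at most \<open>k\<close> each,
  hence 8 * 2 k = 16 k.\<close>

lemma sdp_error_le:
  fixes x :: "nat \<times> nat \<Rightarrow> nat \<Rightarrow> real"
  assumes X: "sdp_feasible k (k * n) X" and k: "1 \<le> k"
    and \<gamma>: "\<forall>a<k. \<gamma> a \<in> carrier_vec m"
    and Gram: "\<And>j l. j < m \<Longrightarrow> l < m \<Longrightarrow>
      \<bar>(\<Sum>q<k * n. (x (q div n, q mod n) j - \<gamma> (q div n) $ j) * (x (q div n, q mod n) l - \<gamma> (q div n) $ l))
        - (if j = l then real (k * n) * \<sigma>\<^sup>2 else 0)\<bar> \<le> real (k * n) * \<sigma>\<^sup>2 / m"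
  shows "1 / real (k * n) * (\<Sum>a<k. \<Sum>i<n.
      (l2norm (col (data_mat m k n x * X) (a * n + i) - centroid m n x a))\<^sup>2)
    \<le> 2 * (\<Delta>_max k \<gamma>)\<^sup>2 + 16 * real k * \<sigma>\<^sup>2"
proof (cases "n = 0")
  case False
  let ?N = "k * n" and ?s = "real (k * n) * \<sigma>\<^sup>2"
  let ?e = "\<lambda>p. (l2norm (col (data_mat m k n x * X) p - centroid m n x (p div n)))\<^sup>2"
  have N: "real ?N > 0" using k False by simp
  have "(\<Sum>a<k. \<Sum>i<n. (l2norm (col (data_mat m k n x * X) (a * n + i) - centroid m n x a))\<^sup>2)
      = (\<Sum>p<?N. ?e p)"
    unfolding sum_blocks[symmetric] by (intro sum.cong refl) simp
  also have "\<dots> \<le> (\<Sum>p<?N. 2 * (\<Delta>_max k \<gamma>)\<^sup>2 + 8 * ?s * ((\<Sum>q<?N. (X $$ (q, p))\<^sup>2) + 1 / n))"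
    using Gram by (intro sum_mono sdp_column_error_le[OF X _ \<gamma>]) auto
  \<comment> \<open>Summing \<open>1 / n\<close> over all k n columns gives
    \<open>k\<close>.\<close>
  also have "\<dots> = real ?N * (2 * (\<Delta>_max k \<gamma>)\<^sup>2) + 8 * ?s * ((\<Sum>p<?N. \<Sum>q<?N. (X $$ (q, p))\<^sup>2) + k)"
    using False by (simp add: sum.distrib flip: sum_distrib_left)
  also have "\<dots> \<le> real ?N * (2 * (\<Delta>_max k \<gamma>)\<^sup>2) + 8 * ?s * (real k + k)"
    using sdp_feasible_Frobenius_le[OF X] by (intro add_left_mono mult_left_mono) auto
  also have "\<dots> = real ?N * (2 * (\<Delta>_max k \<gamma>)\<^sup>2 + 16 * real k * \<sigma>\<^sup>2)"
    by (simp add: algebra_simps)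
  finally show ?thesis using N by (simp add: field_simps)
\<comment> \<open>For \<open>n = 0\<close> the left-hand side is 0.\<close>
qed (simp add: sum_nonneg)

section \<open>Second moments under product measures\<close>

text \<open>Padding with the constant factor 1 outside \<open>J\<close> reduces this to the product
  over all of \<open>I\<close>; the added factors integrate to 1 because each \<open>M i\<close> is
  a probability space.\<close>

lemma
  fixes M :: "'i \<Rightarrow> 'a measure" and f :: "'i \<Rightarrow> 'a \<Rightarrow> real"
  assumes M: "\<And>i. prob_space (M i)" and I: "finite I" and J: "J \<subseteq> I"
    and f: "\<And>i. i \<in> J \<Longrightarrow> integrable (M i) (f i)"
  shows integrable_PiM_prod_subset: "integrable (Pi\<^sub>M I M) (\<lambda>\<omega>. \<Prod>i\<in>J. f i (\<omega> i))"
    and integral_PiM_prod_subset: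
      "(\<integral>\<omega>. (\<Prod>i\<in>J. f i (\<omega> i)) \<partial>Pi\<^sub>M I M) = (\<Prod>i\<in>J. \<integral>x. f i x \<partial>M i)"
proof -
  interpret product_prob_space M I
    by (intro product_prob_space.intro product_prob_space_axioms.intro product_sigma_finite.intro
        prob_space_imp_sigma_finite M)
  define h where "h i = (if i \<in> J then f i else (\<lambda>_. 1))" for i
  have h: "integrable (M i) (h i)" for i using f by (simp add: h_def)
  have eq: "(\<Prod>i\<in>I. if i \<in> J then c i else 1) = prod c J" for c :: "'i \<Rightarrow> real"
    using I J by (simp add: prod.If_cases Int_absorb1)
  have 1: "(\<Prod>i\<in>I. h i (\<omega> i)) = (\<Prod>i\<in>J. f i (\<omega> i))" for \<omega>
    unfolding eq[symmetric] by (intro prod.cong) (auto simp: h_def)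
  have 2: "(\<Prod>i\<in>I. \<integral>x. h i x \<partial>M i) = (\<Prod>i\<in>J. \<integral>x. f i x \<partial>M i)"
    unfolding eq[symmetric] by (intro prod.cong) (auto simp: h_def M.prob_space)
  show "integrable (Pi\<^sub>M I M) (\<lambda>\<omega>. \<Prod>i\<in>J. f i (\<omega> i))"
    using product_integrable_prod[OF I h] by (simp add: 1)
  show "(\<integral>\<omega>. (\<Prod>i\<in>J. f i (\<omega> i)) \<partial>Pi\<^sub>M I M) = (\<Prod>i\<in>J. \<integral>x. f i x \<partial>M i)"
    using product_integral_prod[OF I h] by (simp add: 1 2)
qed

text \<open>Expanding the square, independence and mean zero kill the off-diagonal products; only
  the diagonal survives.\<close>

lemma
  fixes M :: "'i \<Rightarrow> 'a measure" and f :: "'i \<Rightarrow> 'a \<Rightarrow> real"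
  assumes M: "\<And>i. prob_space (M i)" and I: "finite I"
    and f: "\<And>i. i \<in> I \<Longrightarrow> integrable (M i) (f i)"
    and f2: "\<And>i. i \<in> I \<Longrightarrow> integrable (M i) (\<lambda>x. (f i x)\<^sup>2)"
    and f0: "\<And>i. i \<in> I \<Longrightarrow> (\<integral>x. f i x \<partial>M i) = 0"
  shows integrable_PiM_sum_square: "integrable (Pi\<^sub>M I M) (\<lambda>\<omega>. (\<Sum>i\<in>I. f i (\<omega> i))\<^sup>2)"
    and integral_PiM_sum_square:
      "(\<integral>\<omega>. (\<Sum>i\<in>I. f i (\<omega> i))\<^sup>2 \<partial>Pi\<^sub>M I M) = (\<Sum>i\<in>I. \<integral>x. (f i x)\<^sup>2 \<partial>M i)"
proof -
  have pair: "integrable (Pi\<^sub>M I M) (\<lambda>\<omega>. f i (\<omega> i) * f j (\<omega> j)) \<and>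
      (\<integral>\<omega>. f i (\<omega> i) * f j (\<omega> j) \<partial>Pi\<^sub>M I M) = (if i = j then \<integral>x. (f i x)\<^sup>2 \<partial>M i else 0)"
    if "i \<in> I" "j \<in> I" for i j
  proof (cases "i = j")
    case True
    then show ?thesis
      using integrable_PiM_prod_subset[where M = M, OF M I, where J = "{i}" and f = "\<lambda>i x. (f i x)\<^sup>2"]
        integral_PiM_prod_subset[where M = M, OF M I, where J = "{i}" and f = "\<lambda>i x. (f i x)\<^sup>2"] f2 that
      by (simp add: power2_eq_square)
  next
    case False
    then show ?thesis
      using integrable_PiM_prod_subset[where M = M, OF M I, where J = "{i, j}" and f = f]
        integral_PiM_prod_subset[where M = M, OF M I, where J = "{i, j}" and f = f] f f0 that by auto
  qed
  have eq: "(\<Sum>i\<in>I. f i (\<omega> i))\<^sup>2 = (\<Sum>i\<in>I. \<Sum>j\<in>I. f i (\<omega> i) * f j (\<omega> j))" for \<omega>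
    by (simp add: power2_eq_square sum_product)
  show "integrable (Pi\<^sub>M I M) (\<lambda>\<omega>. (\<Sum>i\<in>I. f i (\<omega> i))\<^sup>2)"
    unfolding eq using pair by (intro Bochner_Integration.integrable_sum) auto
  show "(\<integral>\<omega>. (\<Sum>i\<in>I. f i (\<omega> i))\<^sup>2 \<partial>Pi\<^sub>M I M) = (\<Sum>i\<in>I. \<integral>x. (f i x)\<^sup>2 \<partial>M i)"
    unfolding eq using pair I by (simp add: Bochner_Integration.integral_sum)
qed

text \<open>Chebyshev's inequality for a sum of independent centered terms.\<close>

lemma prob_PiM_sum_ge_le:
  fixes M :: "'i \<Rightarrow> 'a measure" and f :: "'i \<Rightarrow> 'a \<Rightarrow> real"
  assumes M: "\<And>i. prob_space (M i)" and I: "finite I" and t: "t > 0"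
    and f: "\<And>i. i \<in> I \<Longrightarrow> integrable (M i) (f i)"
    and f2: "\<And>i. i \<in> I \<Longrightarrow> integrable (M i) (\<lambda>x. (f i x)\<^sup>2)"
    and f0: "\<And>i. i \<in> I \<Longrightarrow> (\<integral>x. f i x \<partial>M i) = 0"
  shows "measure (Pi\<^sub>M I M) {\<omega> \<in> space (Pi\<^sub>M I M). \<bar>\<Sum>i\<in>I. f i (\<omega> i)\<bar> \<ge> t}
    \<le> (\<Sum>i\<in>I. \<integral>x. (f i x)\<^sup>2 \<partial>M i) / t\<^sup>2"
proof -
  interpret P: prob_space "Pi\<^sub>M I M" using M by (rule prob_space_PiM)
  have [measurable]: "f i \<in> borel_measurable (M i)" if "i \<in> I" for i
    using f[OF that] by auto
  show ?thesis
    using P.second_moment_method[of "\<lambda>\<omega>. \<Sum>i\<in>I. f i (\<omega> i)" t] t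
      integrable_PiM_sum_square[OF M I f f2 f0] integral_PiM_sum_square[OF M I f f2 f0]
    by simp
qed

section \<open>Gaussian moments\<close>

lemma prob_space_spherical_gaussian:
  "\<sigma> > 0 \<Longrightarrow> prob_space (spherical_gaussian m \<mu> \<sigma>)"
  unfolding spherical_gaussian_def by (intro prob_space_PiM prob_space_normal_density)

lemma integrable_normal_power:
  "\<sigma> > 0 \<Longrightarrow> integrable (density lborel (normal_density \<mu> \<sigma>)) (\<lambda>x. (x - \<mu>) ^ r)"
  by (subst integrable_density) (auto intro: integrable_normal_moment)

lemma integral_normal_power:
  "\<sigma> > 0 \<Longrightarrow> (\<integral>x. (x - \<mu>) ^ r \<partial>density lborel (normal_density \<mu> \<sigma>)) =
    (\<integral>x. normal_density \<mu> \<sigma> x * (x - \<mu>) ^ r \<partial>lborel)"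
  by (subst integral_density) auto

text \<open>The exponent \<open>r\<close> is used with 1 for a product of two coordinates and with 2
  for its square. If \<open>j = l\<close>, both factors live on one coordinate and merge into a
  power \<open>r + r\<close>; otherwise they are independent.\<close>

lemma
  assumes \<sigma>: "\<sigma> > 0" and jl: "j < m" "l < m"
  shows integrable_spherical_gaussian_power_prod:
      "integrable (spherical_gaussian m \<mu> \<sigma>) (\<lambda>x. (x j - \<mu> $ j) ^ r * (x l - \<mu> $ l) ^ r)"
    and integral_spherical_gaussian_prod:
      "(\<integral>x. (x j - \<mu> $ j) * (x l - \<mu> $ l) \<partial>spherical_gaussian m \<mu> \<sigma>) =
        (if j = l then \<sigma>\<^sup>2 else 0)"
proof -
  let ?D = "\<lambda>j. density lborel (normal_density (\<mu> $ j) \<sigma>)"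
  have D: "prob_space (?D j)" for j by (rule prob_space_normal_density[OF \<sigma>])
  note integrable = integrable_PiM_prod_subset[of ?D "{..<m}", OF D finite_lessThan, folded spherical_gaussian_def]
  note integral = integral_PiM_prod_subset[of ?D "{..<m}", OF D finite_lessThan, folded spherical_gaussian_def]
  note power = integrable_normal_power[OF \<sigma>]
  have m1: "(\<integral>x. x - \<mu> $ j \<partial>?D j) = 0" for j
    using integral_normal_power[OF \<sigma>, of "\<mu> $ j" 1] integral_normal_moment_odd[OF \<sigma>, of "\<mu> $ j" 0]
    by simp
  have m2: "(\<integral>x. (x - \<mu> $ j)\<^sup>2 \<partial>?D j) = \<sigma>\<^sup>2" for j
  proof -
    \<comment> \<open>The general formula for even moments, (2i)! / ((2 / \<sigma>^2)^i i!), at i =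
      1.\<close>
    have "fact 2 / (2 / \<sigma>\<^sup>2 * fact 1) = \<sigma>\<^sup>2" using \<sigma> by (simp add: fact_numeral)
    then show ?thesis
      using integral_normal_power[OF \<sigma>, of "\<mu> $ j" 2] integral_normal_moment_even[OF \<sigma>, of "\<mu> $ j" 1]
      by simp
  qed
  show "integrable (spherical_gaussian m \<mu> \<sigma>) (\<lambda>x. (x j - \<mu> $ j) ^ r * (x l - \<mu> $ l) ^ r)"
  proof (cases "j = l")
    case True
    then show ?thesis
      using integrable[where J = "{j}" and f = "\<lambda>j x. (x - \<mu> $ j) ^ (r + r)"] jl power[of _ "r + r"]
      by (simp add: power_add)
  next
    case False
    then show ?thesis
      using integrable[where J = "{j, l}" and f = "\<lambda>j x. (x - \<mu> $ j) ^ r"] jl power by simp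
  qed
  show "(\<integral>x. (x j - \<mu> $ j) * (x l - \<mu> $ l) \<partial>spherical_gaussian m \<mu> \<sigma>) = (if j = l then \<sigma>\<^sup>2 else 0)"
  proof (cases "j = l")
    case True
    then show ?thesis
      using integral[where J = "{j}" and f = "\<lambda>j x. (x - \<mu> $ j)\<^sup>2"] jl power[of _ 2] m2
      by (simp add: power2_eq_square)
  next
    case False
    then show ?thesis
      using integral[where J = "{j, l}" and f = "\<lambda>j x. x - \<mu> $ j"] jl power[of _ 1] m1 by simp
  qed
qed

text \<open>The three conditions that \<open>prob_PiM_sum_ge_le\<close> imposes on the contribution
  of a single sample point.\<close>

lemma
  assumes \<sigma>: "\<sigma> > 0" and jl: "j < m" "l < m"
  shows integrable_gaussian_cov_dev:
      "integrable (spherical_gaussian m \<mu> \<sigma>)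
        (\<lambda>x. (x j - \<mu> $ j) * (x l - \<mu> $ l) - (if j = l then \<sigma>\<^sup>2 else 0))"
    and integrable_gaussian_cov_dev_square:
      "integrable (spherical_gaussian m \<mu> \<sigma>)
        (\<lambda>x. ((x j - \<mu> $ j) * (x l - \<mu> $ l) - (if j = l then \<sigma>\<^sup>2 else 0))\<^sup>2)"
    and integral_gaussian_cov_dev:
      "(\<integral>x. (x j - \<mu> $ j) * (x l - \<mu> $ l) - (if j = l then \<sigma>\<^sup>2 else 0)
        \<partial>spherical_gaussian m \<mu> \<sigma>) = 0"
proof -
  interpret prob_space "spherical_gaussian m \<mu> \<sigma>" by (rule prob_space_spherical_gaussian[OF \<sigma>])
  note i = integrable_spherical_gaussian_power_prod[OF \<sigma> jl, of \<mu>]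
  note i1 = i[of 1, simplified] and i2 = i[of 2, folded power_mult_distrib]
  show "integrable (spherical_gaussian m \<mu> \<sigma>)
        (\<lambda>x. (x j - \<mu> $ j) * (x l - \<mu> $ l) - (if j = l then \<sigma>\<^sup>2 else 0))"
    using i1 by simp
  show "integrable (spherical_gaussian m \<mu> \<sigma>)
        (\<lambda>x. ((x j - \<mu> $ j) * (x l - \<mu> $ l) - (if j = l then \<sigma>\<^sup>2 else 0))\<^sup>2)"
    unfolding power2_diff using i1 i2
    by (intro Bochner_Integration.integrable_add Bochner_Integration.integrable_diff
      integrable_mult_left integrable_mult_right) auto
  show "(\<integral>x. (x j - \<mu> $ j) * (x l - \<mu> $ l) - (if j = l then \<sigma>\<^sup>2 else 0)
        \<partial>spherical_gaussian m \<mu> \<sigma>) = 0"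
    using i1 integral_spherical_gaussian_prod[OF \<sigma> jl, of \<mu>] by (simp add: prob_space)
qed

section \<open>Concentration of the noise Gram matrix\<close>

lemma prob_space_mixture_sample:
  "\<sigma> > 0 \<Longrightarrow> prob_space (mixture_sample m k n \<gamma> \<sigma>)"
  unfolding mixture_sample_def
  by (intro prob_space_PiM) (auto intro: prob_space_spherical_gaussian)

text \<open>Entry (j, l) of G G^T - N \<sigma>^2 I for the noise matrix G. The correction sits
  inside the sum so that the terms are independent and centered.\<close>

definition cov_dev ::
  "nat \<Rightarrow> nat \<Rightarrow> (nat \<Rightarrow> real vec) \<Rightarrow> real \<Rightarrow> nat \<Rightarrow> nat \<Rightarrow> (nat \<times> nat \<Rightarrow> nat \<Rightarrow> real) \<Rightarrow> real" where
  "cov_dev k n \<gamma> \<sigma> j l x = (\<Sum>p\<in>{..<k} \<times> {..<n}.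
     (x p j - \<gamma> (fst p) $ j) * (x p l - \<gamma> (fst p) $ l) - (if j = l then \<sigma>\<^sup>2 else 0))"

lemma measurable_cov_dev:
  assumes "j < m" "l < m" "\<sigma> > 0"
  shows "cov_dev k n \<gamma> \<sigma> j l \<in> borel_measurable (mixture_sample m k n \<gamma> \<sigma>)"
  unfolding cov_dev_def mixture_sample_def
proof (rule borel_measurable_sum)
  fix p assume p: "p \<in> {..<k} \<times> {..<n}"
  let ?M = "\<lambda>(a, i::nat). spherical_gaussian m (\<gamma> a) \<sigma>"
  let ?f = "\<lambda>x. (x j - \<gamma> (fst p) $ j) * (x l - \<gamma> (fst p) $ l) - (if j = l then \<sigma>\<^sup>2 else 0)"
  have "?f \<in> borel_measurable (?M p)"
    using integrable_gaussian_cov_dev[OF assms(3,1,2), of "\<gamma> (fst p)"] by (auto simp: split_beta)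
  moreover have "(\<lambda>x. x p) \<in> Pi\<^sub>M ({..<k} \<times> {..<n}) ?M \<rightarrow>\<^sub>M ?M p"
    by (rule measurable_component_singleton[OF p])
  ultimately
  show "(\<lambda>x. (x p j - \<gamma> (fst p) $ j) * (x p l - \<gamma> (fst p) $ l) - (if j = l then \<sigma>\<^sup>2 else 0))
      \<in> borel_measurable (Pi\<^sub>M ({..<k} \<times> {..<n}) ?M)"
    by (rule measurable_compose[where g = ?f, rotated])
qed

text \<open>The second moment of the deviation grows linearly in \<open>n\<close>, the squared
  threshold quadratically, so Chebyshev's bound is O(1 / n).\<close>

lemma prob_cov_dev_ge_tendsto_0:
  assumes \<sigma>: "\<sigma> > 0" and jl: "j < m" "l < m" and \<epsilon>: "\<epsilon> > 0"
  shows "(\<lambda>n. measure (mixture_sample m k n \<gamma> \<sigma>)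
    {x \<in> space (mixture_sample m k n \<gamma> \<sigma>). \<bar>cov_dev k n \<gamma> \<sigma> j l x\<bar> \<ge> real n * \<epsilon>}) \<longlonglongrightarrow> 0"
proof -
  \<comment> \<open>One sample point per cluster; this does not depend on \<open>n\<close>.\<close>
  define V where "V = (\<Sum>a<k. \<integral>x. ((x j - \<gamma> a $ j) * (x l - \<gamma> a $ l) - (if j = l then \<sigma>\<^sup>2 else 0))\<^sup>2
    \<partial>spherical_gaussian m (\<gamma> a) \<sigma>)"
  have "measure (mixture_sample m k n \<gamma> \<sigma>)
      {x \<in> space (mixture_sample m k n \<gamma> \<sigma>). \<bar>cov_dev k n \<gamma> \<sigma> j l x\<bar> \<ge> real n * \<epsilon>}
    \<le> V / \<epsilon>\<^sup>2 / n" if n: "n > 0" for n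
  proof -
    have "measure (mixture_sample m k n \<gamma> \<sigma>)
        {x \<in> space (mixture_sample m k n \<gamma> \<sigma>). \<bar>cov_dev k n \<gamma> \<sigma> j l x\<bar> \<ge> real n * \<epsilon>}
      \<le> (\<Sum>p\<in>{..<k} \<times> {..<n}. \<integral>x. ((x j - \<gamma> (fst p) $ j) * (x l - \<gamma> (fst p) $ l)
          - (if j = l then \<sigma>\<^sup>2 else 0))\<^sup>2 \<partial>spherical_gaussian m (\<gamma> (fst p)) \<sigma>) / (real n * \<epsilon>)\<^sup>2"
      unfolding mixture_sample_def cov_dev_def split_beta
      using n \<epsilon> integrable_gaussian_cov_dev[OF \<sigma> jl] integrable_gaussian_cov_dev_square[OF \<sigma> jl]
        integral_gaussian_cov_dev[OF \<sigma> jl]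
      by (intro prob_PiM_sum_ge_le prob_space_spherical_gaussian \<sigma>) auto
    also have "(\<Sum>p\<in>{..<k} \<times> {..<n}. \<integral>x. ((x j - \<gamma> (fst p) $ j) * (x l - \<gamma> (fst p) $ l)
        - (if j = l then \<sigma>\<^sup>2 else 0))\<^sup>2 \<partial>spherical_gaussian m (\<gamma> (fst p)) \<sigma>) = real n * V"
    proof -
      have "(\<Sum>p\<in>{..<k} \<times> {..<n}. F (fst p)) = real n * (\<Sum>a<k. F a)" for F :: "nat \<Rightarrow> real"
        using sum.cartesian_product[of "\<lambda>a i. F a" "{..<n}" "{..<k}"]
        by (simp add: split_beta sum_distrib_left)
      then show ?thesis unfolding V_def .
    qed
    also have "real n * V / (real n * \<epsilon>)\<^sup>2 = V / \<epsilon>\<^sup>2 / n"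
      using n by (simp add: power2_eq_square)
    finally show ?thesis .
  qed
  then have "\<forall>\<^sub>F n in sequentially. norm (measure (mixture_sample m k n \<gamma> \<sigma>)
      {x \<in> space (mixture_sample m k n \<gamma> \<sigma>). \<bar>cov_dev k n \<gamma> \<sigma> j l x\<bar> \<ge> real n * \<epsilon>}) \<le> V / \<epsilon>\<^sup>2 / n"
    by (intro eventually_sequentiallyI[of 1]) simp
  then show ?thesis by (rule Lim_null_comparison) (rule lim_const_over_n)
qed

text \<open>Union bound over the m^2 entries, a number independent of \<open>n\<close>; the
  complement of the bad events is the required measurable event.\<close>

lemma with_high_probability_cov_dev_less:
  assumes \<sigma>: "\<sigma> > 0" and \<epsilon>: "\<epsilon> > 0"
  shows "with_high_probability (\<lambda>n. mixture_sample m k n \<gamma> \<sigma>)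
    (\<lambda>n x. \<forall>j<m. \<forall>l<m. \<bar>cov_dev k n \<gamma> \<sigma> j l x\<bar> < real n * \<epsilon>)"
proof -
  let ?M = "\<lambda>n. mixture_sample m k n \<gamma> \<sigma>"
  define B where "B n p = {x \<in> space (?M n). \<bar>cov_dev k n \<gamma> \<sigma> (fst p) (snd p) x\<bar> \<ge> real n * \<epsilon>}" for n p
  define U where "U n = (\<Union>p\<in>{..<m} \<times> {..<m}. B n p)" for n
  have B: "B n p \<in> sets (?M n)" if "p \<in> {..<m} \<times> {..<m}" for n p
  proof -
    have [measurable]: "cov_dev k n \<gamma> \<sigma> (fst p) (snd p) \<in> borel_measurable (?M n)"
      using that \<sigma> by (intro measurable_cov_dev) auto
    show ?thesis unfolding B_def by measurable
  qed
  then have U: "U n \<in> sets (?M n)" for n unfolding U_def by auto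
  have lim: "(\<lambda>n. \<Sum>p\<in>{..<m} \<times> {..<m}. measure (?M n) (B n p)) \<longlonglongrightarrow> (\<Sum>p\<in>{..<m} \<times> {..<m}. 0)"
    unfolding B_def by (intro tendsto_sum prob_cov_dev_ge_tendsto_0[OF \<sigma> _ _ \<epsilon>]) auto
  have le: "measure (?M n) (U n) \<le> (\<Sum>p\<in>{..<m} \<times> {..<m}. measure (?M n) (B n p))" for n
    unfolding U_def using B by (intro measure_UNION_le) auto
  have "(\<lambda>n. measure (?M n) (U n)) \<longlonglongrightarrow> 0"
    by (rule Lim_null_comparison[where g = "\<lambda>n. \<Sum>p\<in>{..<m} \<times> {..<m}. measure (?M n) (B n p)"]) (use le lim in simp_all)
  then have "(\<lambda>n. 1 - measure (?M n) (U n)) \<longlonglongrightarrow> 1 - 0" by (intro tendsto_diff tendsto_const)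
  moreover have "measure (?M n) (space (?M n) - U n) = 1 - measure (?M n) (U n)" for n
    using prob_space.prob_compl[OF prob_space_mixture_sample[OF \<sigma>] U] .
  ultimately have "(\<lambda>n. measure (?M n) (space (?M n) - U n)) \<longlonglongrightarrow> 1" by simp
  then show ?thesis
    unfolding with_high_probability_def using U
    by (intro exI[of _ "\<lambda>n. space (?M n) - U n"]) (auto simp: U_def B_def not_le)
qed

text \<open>Passes from pairs (a, i), which index the product measure, to column numbers, which
  index the matrices.\<close>

lemma cov_dev_eq:
  "cov_dev k n \<gamma> \<sigma> j l x =
    (\<Sum>q<k * n. (x (q div n, q mod n) j - \<gamma> (q div n) $ j) * (x (q div n, q mod n) l - \<gamma> (q div n) $ l))
      - (if j = l then real (k * n) * \<sigma>\<^sup>2 else 0)"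
proof -
  let ?f = "\<lambda>a i. (x (a, i) j - \<gamma> a $ j) * (x (a, i) l - \<gamma> a $ l)"
  have "(\<Sum>q<k * n. ?f (q div n) (q mod n)) = (\<Sum>a<k. \<Sum>i<n. ?f a i)"
    unfolding sum_blocks[symmetric] by (intro sum.cong refl) simp
  also have "\<dots> = (\<Sum>p\<in>{..<k} \<times> {..<n}. ?f (fst p) (snd p))"
    by (simp add: sum.cartesian_product split_beta)
  finally show ?thesis by (simp add: cov_dev_def sum_subtractf)
qed

section \<open>Choice of the constant and conclusion\<close>

lemma with_high_probability_mono:
  assumes "with_high_probability M P" and "\<And>n \<omega>. P n \<omega> \<Longrightarrow> Q n \<omega>"
  shows "with_high_probability M Q"
  using assms unfolding with_high_probability_def by blast

theorem corollary3:
  fixes c c' :: real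
  assumes "c > 0" and "c' > 0"
  shows "\<exists>C>0. \<forall>(k::nat) (m::nat) (\<sigma>::real) (\<gamma> :: nat \<Rightarrow> real vec) (K::real).
    k \<ge> 2 \<longrightarrow> m \<ge> 1 \<longrightarrow> \<sigma> > 0 \<longrightarrow>
    (\<forall>a<k. \<gamma> a \<in> carrier_vec m) \<longrightarrow> inj_on \<gamma> {..<k} \<longrightarrow> K > 0 \<longrightarrow>
    c * real k * \<sigma> \<le> \<Delta>_min k \<gamma> \<longrightarrow> \<Delta>_min k \<gamma> \<le> \<Delta>_max k \<gamma> \<longrightarrow> \<Delta>_max k \<gamma> \<le> c' * K * \<sigma> \<longrightarrow>
    with_high_probability (\<lambda>n. mixture_sample m k n \<gamma> \<sigma>)
      (\<lambda>n x. \<forall>X. sdp_minimizer k (k * n) (sq_dist_mat (data_mat m k n x)) X \<longrightarrow>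
         1 / real (k * n) *
           (\<Sum>a<k. \<Sum>i<n.
              (l2norm (col (data_mat m k n x * X) (a * n + i) - centroid m n x a))\<^sup>2)
         \<le> C * K\<^sup>2 * \<sigma>\<^sup>2)"
proof (intro exI conjI allI impI)
  \<comment> \<open>The first term comes from \<open>2 * (\<Delta>_max k \<gamma>)\<^sup>2\<close>,
    the second from \<open>16 * real k * \<sigma>\<^sup>2\<close> once \<open>k\<close> is bounded
    by (c' / c)^2 K^2.\<close>
  show "2 * c'\<^sup>2 + 16 * (c' / c)\<^sup>2 > 0" using assms by (simp add: add_pos_pos)
next
  fix k m :: nat and \<sigma> :: real and \<gamma> :: "nat \<Rightarrow> real vec" and K :: real
  assume k: "k \<ge> 2" and m: "m \<ge> 1" and \<sigma>: "\<sigma> > 0" and \<gamma>: "\<forall>a<k. \<gamma> a \<in> carrier_vec m"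
    and "\<Delta>_min k \<gamma> \<le> \<Delta>_max k \<gamma>"
    and lower: "c * real k * \<sigma> \<le> \<Delta>_min k \<gamma>" and upper: "\<Delta>_max k \<gamma> \<le> c' * K * \<sigma>"
  then have chain: "c * real k * \<sigma> \<le> \<Delta>_max k \<gamma>" by linarith
  \<comment> \<open>Supplies \<open>0 \<le> \<Delta>_max k \<gamma>\<close>, needed for squaring the
    upper bound.\<close>
  have "0 \<le> c * real k * \<sigma>" using assms \<sigma> by simp
  then have "(\<Delta>_max k \<gamma>)\<^sup>2 \<le> (c' * K * \<sigma>)\<^sup>2" using chain upper by (intro power_mono) auto
  then have \<Delta>: "(\<Delta>_max k \<gamma>)\<^sup>2 \<le> c'\<^sup>2 * K\<^sup>2 * \<sigma>\<^sup>2" by (simp add: power_mult_distrib)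
  have "c * real k * \<sigma> \<le> c' * K * \<sigma>" using chain upper by linarith
  then have "real k \<le> c' / c * K" using assms \<sigma> by (simp add: field_simps)
  then have "(real k)\<^sup>2 \<le> (c' / c * K)\<^sup>2" by (intro power_mono) auto
  moreover have "real k \<le> (real k)\<^sup>2" using k by (simp add: power2_eq_square)
  ultimately have k2: "real k \<le> (c' / c)\<^sup>2 * K\<^sup>2"
    unfolding power_mult_distrib[symmetric] by linarith
  have const: "2 * (\<Delta>_max k \<gamma>)\<^sup>2 + 16 * real k * \<sigma>\<^sup>2 \<le> (2 * c'\<^sup>2 + 16 * (c' / c)\<^sup>2) * K\<^sup>2 * \<sigma>\<^sup>2"
    using \<Delta> mult_right_mono[OF k2, of "\<sigma>\<^sup>2"] by (simp only: distrib_right mult.assoc) simp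
  \<comment> \<open>This tolerance times \<open>n\<close> is N \<sigma>^2 / m, the accuracy that
    \<open>sdp_error_le\<close> asks of each Gram entry.\<close>
  have "real k * \<sigma>\<^sup>2 / m > 0" using k m \<sigma> by simp
  from with_high_probability_cov_dev_less[OF \<sigma> this, of m k \<gamma>]
  show "with_high_probability (\<lambda>n. mixture_sample m k n \<gamma> \<sigma>)
      (\<lambda>n x. \<forall>X. sdp_minimizer k (k * n) (sq_dist_mat (data_mat m k n x)) X \<longrightarrow>
         1 / real (k * n) *
           (\<Sum>a<k. \<Sum>i<n.
              (l2norm (col (data_mat m k n x * X) (a * n + i) - centroid m n x a))\<^sup>2)
         \<le> (2 * c'\<^sup>2 + 16 * (c' / c)\<^sup>2) * K\<^sup>2 * \<sigma>\<^sup>2)"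
  proof (rule with_high_probability_mono, intro allI impI)
    fix n x X
    \<comment> \<open>The event constrains the noise alone, so it serves all minimizers
      \<open>X\<close> simultaneously.\<close>
    assume dev: "\<forall>j<m. \<forall>l<m. \<bar>cov_dev k n \<gamma> \<sigma> j l x\<bar> < real n * (real k * \<sigma>\<^sup>2 / m)"
      and min: "sdp_minimizer k (k * n) (sq_dist_mat (data_mat m k n x)) X"
    have "\<bar>cov_dev k n \<gamma> \<sigma> j l x\<bar> \<le> real (k * n) * \<sigma>\<^sup>2 / m" if "j < m" "l < m" for j l
      using dev that by (auto simp: mult_ac intro: less_imp_le)
    moreover have "sdp_feasible k (k * n) X"
      using min by (simp add: sdp_minimizer_def is_arg_min_def)
    ultimately have "1 / real (k * n) * (\<Sum>a<k. \<Sum>i<n.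
        (l2norm (col (data_mat m k n x * X) (a * n + i) - centroid m n x a))\<^sup>2)
      \<le> 2 * (\<Delta>_max k \<gamma>)\<^sup>2 + 16 * real k * \<sigma>\<^sup>2"
      using k \<gamma> by (intro sdp_error_le) (auto simp flip: cov_dev_eq)
    then show "1 / real (k * n) * (\<Sum>a<k. \<Sum>i<n.
        (l2norm (col (data_mat m k n x * X) (a * n + i) - centroid m n x a))\<^sup>2)
      \<le> (2 * c'\<^sup>2 + 16 * (c' / c)\<^sup>2) * K\<^sup>2 * \<sigma>\<^sup>2"
      using const by linarith
  qed
qed

end
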